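(* If $\Delta$ is a profinite subgroup of a torus-free protorus $G$ such that $G/\Delta\cong_t\mathbb{T}^{\dim G}$, then $\overline{\mathbb{Z}_\Delta}=\Delta$ (closure in $G$) and $\mathbb{Z}_\Delta$ is closed in the subspace $\exp_G\mathfrak{L}(G)$.
   Context: All groups are abelian, topological groups are Hausdorff, compact groups are finite-dimensional. $\cong_t$ denotes topological isomorphism; $\mathbb{T}=\mathbb{R}/\mathbb{Z}$. A protorus is a compact connected abelian group; it is torus-free if it contains no subgroup $\cong_t\mathbb{T}^k$, $k$ a positive integer. $\mathfrak{L}(G)$ is the real topological vector space of continuous homomorphisms $\mathbb{R}\to G$ (topology of compact convergence), $\exp_G:\mathfrak{L}(G)\to G$ is $\exp_G(r)=r(1)$, $\dim G=\dim_{\mathbb{R}}\mathfrak{L}(G)$, and $\mathbb{Z}_\Delta=\Delta\cap\exp_G\mathfrak{L}(G)$. *)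

theory Defs
  imports "HOL-Analysis.Analysis" "HOL-Algebra.Algebra" "Jordan_Normal_Form.VS_Connect"
begin

section \<open>Topological abelian groups\<close>

record 'a tgroup = "'a monoid" + topo :: "'a topology"

locale topological_abelian_group = comm_group G for G :: "('a, 'm) tgroup_scheme" (structure) +
  assumes topspace_eq: "topspace (topo G) = carrier G"
    and Hausdorff: "Hausdorff_space (topo G)"
    and continuous_mult:
      "continuous_map (prod_topology (topo G) (topo G)) (topo G) (\<lambda>(x, y). x \<otimes> y)"
    and continuous_inv: "continuous_map (topo G) (topo G) (\<lambda>x. inv x)"

definition top_iso :: "('a, 'm) tgroup_scheme \<Rightarrow> ('b, 'n) tgroup_scheme \<Rightarrow> bool" (infix "\<cong>\<^sub>t" 50)
  where "G \<cong>\<^sub>t H \<longleftrightarrow> (\<exists>f \<in> iso G H. homeomorphic_map (topo G) (topo H) f)"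

definition subgroup_space :: "'a tgroup \<Rightarrow> 'a set \<Rightarrow> 'a tgroup"
  where "subgroup_space G H = G\<lparr>carrier := H, topo := subtopology (topo G) H\<rparr>"

definition quotient_topology :: "'a tgroup \<Rightarrow> 'a set \<Rightarrow> 'a set topology"
  where "quotient_topology G H = topology (\<lambda>U. U \<subseteq> rcosets\<^bsub>G\<^esub> H \<and>
           openin (topo G) {x \<in> carrier G. H #>\<^bsub>G\<^esub> x \<in> U})"

definition quotient_space :: "'a tgroup \<Rightarrow> 'a set \<Rightarrow> 'a set tgroup"
  where "quotient_space G H =
           monoid.extend (G Mod H) (tgroup.fields (quotient_topology G H))"

definition power_space :: "'a tgroup \<Rightarrow> nat \<Rightarrow> (nat \<Rightarrow> 'a) tgroup"
  where "power_space G n =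
           monoid.extend (product_group {..<n} (\<lambda>_. G))
             (tgroup.fields (product_topology (\<lambda>_. topo G) {..<n}))"

definition real_line :: "real tgroup"
  where "real_line = \<lparr>carrier = UNIV, monoid.mult = (+), monoid.one = 0, topo = euclideanreal\<rparr>"

definition circle :: "real set tgroup"
  where "circle = quotient_space real_line \<int>"

abbreviation torus :: "nat \<Rightarrow> (nat \<Rightarrow> real set) tgroup"
  where "torus \<equiv> power_space circle"

locale protorus = topological_abelian_group +
  assumes compact: "compact_space (topo G)"
    and connected: "connected_space (topo G)"

definition torus_free :: "'a tgroup \<Rightarrow> bool"
  where "torus_free G \<longleftrightarrow>
           \<not> (\<exists>H k. subgroup H G \<and> k > 0 \<and> subgroup_space G H \<cong>\<^sub>t torus k)"

text \<open>
  Profinite groups in the intrinsic form: compact Hausdorff and totally disconnected.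
\<close>

locale profinite_group = topological_abelian_group +
  assumes compact: "compact_space (topo G)"
    and totally_disconnected:
      "\<And>x. x \<in> carrier G \<Longrightarrow> connected_component_of_set (topo G) x = {x}"

section \<open>The Lie algebra and the exponential map\<close>

text \<open>
  The continuous homomorphisms from the reals with pointwise addition and
  \<open>(a r)(x) = r (a x)\<close>. The topology of compact convergence is not recorded, since neither
  the (algebraic) dimension nor the image of the exponential map depends on it. The ring multiplication and unit in the record
  type \<^typ>\<open>('k, 'v) module\<close> play no role for modules and are left undefined.
\<close>

definition lie :: "'a tgroup \<Rightarrow> (real, real \<Rightarrow> 'a) module"
  where "lie G = \<lparr>
    carrier = {r \<in> hom real_line G. continuous_map (topo real_line) (topo G) r},
    monoid.mult = undefined,
    monoid.one = undefined,
    ring.zero = (\<lambda>x. \<one>\<^bsub>G\<^esub>),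
    ring.add = (\<lambda>r s x. r x \<otimes>\<^bsub>G\<^esub> s x),
    module.smult = (\<lambda>a r x. r (a * x))\<rparr>"

definition lie_exp :: "'a tgroup \<Rightarrow> (real \<Rightarrow> 'a) \<Rightarrow> 'a"
  where "lie_exp G r = r 1"

abbreviation exp_image :: "'a tgroup \<Rightarrow> 'a set"
  where "exp_image G \<equiv> lie_exp G ` carrier (lie G)"

definition finite_dimensional :: "'a tgroup \<Rightarrow> bool"
  where "finite_dimensional G \<longleftrightarrow> vectorspace.fin_dim class_ring (lie G)"

text \<open>Meaningful only if \<open>G\<close> is finite-dimensional.\<close>

definition group_dim :: "'a tgroup \<Rightarrow> nat"
  where "group_dim G = vectorspace.dim class_ring (lie G)"

definition Z_lattice :: "'a tgroup \<Rightarrow> 'a set \<Rightarrow> 'a set"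
  where "Z_lattice G \<Delta> = \<Delta> \<inter> exp_image G"

section \<open>Well-definedness\<close>

lemma openin_quotient_topology:
  "openin (quotient_topology G H) U \<longleftrightarrow>
           U \<subseteq> rcosets\<^bsub>G\<^esub> H \<and> openin (topo G) {x \<in> carrier G. H #>\<^bsub>G\<^esub> x \<in> U}"
proof -
  have *: "{x \<in> carrier G. H #>\<^bsub>G\<^esub> x \<in> S \<inter> T} =
      {x \<in> carrier G. H #>\<^bsub>G\<^esub> x \<in> S} \<inter> {x \<in> carrier G. H #>\<^bsub>G\<^esub> x \<in> T}" for S T
    by auto
  have **: "{x \<in> carrier G. H #>\<^bsub>G\<^esub> x \<in> \<Union>\<K>} =
      (\<Union>K\<in>\<K>. {x \<in> carrier G. H #>\<^bsub>G\<^esub> x \<in> K})" for \<K>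
    by auto
  have "istopology (\<lambda>U. U \<subseteq> rcosets\<^bsub>G\<^esub> H \<and>
          openin (topo G) {x \<in> carrier G. H #>\<^bsub>G\<^esub> x \<in> U})"
    unfolding istopology_def * ** by blast
  then show ?thesis
    by (simp add: quotient_topology_def topology_inverse')
qed

lemma quotient_map_quotient_topology:
  assumes "topological_abelian_group G"
  shows "quotient_map (topo G) (quotient_topology G H) (\<lambda>x. H #>\<^bsub>G\<^esub> x)"
proof -
  interpret topological_abelian_group G by fact
  have "{x \<in> carrier G. H #>\<^bsub>G\<^esub> x \<in> rcosets\<^bsub>G\<^esub> H} = topspace (topo G)"
    by (auto simp: RCOSETS_def topspace_eq)
  then have "openin (quotient_topology G H) (rcosets\<^bsub>G\<^esub> H)"
    by (simp add: openin_quotient_topology)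
  moreover have "topspace (quotient_topology G H) \<subseteq> rcosets\<^bsub>G\<^esub> H"
    using openin_quotient_topology openin_topspace by blast
  ultimately have "topspace (quotient_topology G H) = rcosets\<^bsub>G\<^esub> H"
    by (meson openin_subset subset_antisym)
  then show ?thesis
    by (auto simp: quotient_map_def openin_quotient_topology topspace_eq RCOSETS_def)
qed

lemma vectorspace_lie:
  assumes "topological_abelian_group G"
  shows "vectorspace class_ring (lie G)"
proof -
  interpret G: topological_abelian_group G by fact
  have in_lie: "r \<in> carrier (lie G) \<longleftrightarrow> (\<forall>x. r x \<in> carrier G) \<and>
      (\<forall>x y. r (x + y) = r x \<otimes>\<^bsub>G\<^esub> r y) \<and> continuous_map euclideanreal (topo G) r" for r
    by (auto simp: lie_def hom_def real_line_def)
  have zero_at: "r 0 = \<one>\<^bsub>G\<^esub>" if "r \<in> carrier (lie G)" for r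
    using that G.r_cancel_one'[of "r 0" "r 0"] unfolding in_lie
    by (metis add.left_neutral)
  have add_closed: "(\<lambda>x. r x \<otimes>\<^bsub>G\<^esub> s x) \<in> carrier (lie G)"
    if "r \<in> carrier (lie G)" "s \<in> carrier (lie G)" for r s
  proof -
    have "continuous_map euclideanreal (topo G) ((\<lambda>(x, y). x \<otimes>\<^bsub>G\<^esub> y) \<circ> (\<lambda>x. (r x, s x)))"
      using that by (intro continuous_map_compose[OF _ G.continuous_mult])
        (auto simp: in_lie continuous_map_paired)
    then show ?thesis
      using that by (auto simp: in_lie o_def G.m_ac)
  qed
  have inv_closed: "(\<lambda>x. inv\<^bsub>G\<^esub> r x) \<in> carrier (lie G)" if "r \<in> carrier (lie G)" for r
    using that continuous_map_compose[OF _ G.continuous_inv, of euclideanreal r]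
    by (auto simp: in_lie o_def G.inv_mult)
  have smult_closed: "(\<lambda>x. r (a * x)) \<in> carrier (lie G)" if "r \<in> carrier (lie G)" for r and a :: real
  proof -
    have "continuous_map euclideanreal euclideanreal (\<lambda>x. a * x)"
      by (auto intro: continuous_intros)
    then have "continuous_map euclideanreal (topo G) (r \<circ> (\<lambda>x. a * x))"
      using that by (intro continuous_map_compose) (auto simp: in_lie)
    then show ?thesis
      using that by (auto simp: in_lie o_def distrib_left)
  qed
  have zero_closed: "(\<lambda>x. \<one>\<^bsub>G\<^esub>) \<in> carrier (lie G)"
    by (auto simp: in_lie G.topspace_eq)
  have sel: "ring.zero (lie G) = (\<lambda>x. \<one>\<^bsub>G\<^esub>)" "ring.add (lie G) = (\<lambda>r s x. r x \<otimes>\<^bsub>G\<^esub> s x)"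
    "module.smult (lie G) = (\<lambda>a r x. r (a * x))"
    by (simp_all add: lie_def)
  have val: "r x \<in> carrier G" if "r \<in> carrier (lie G)" for r x
    using that by (simp add: in_lie)
  have val_add: "r (x + y) = r x \<otimes>\<^bsub>G\<^esub> r y" if "r \<in> carrier (lie G)" for r x y
    using that by (simp add: in_lie)
  have ag: "abelian_group (lie G)"
  proof (rule abelian_groupI)
    fix r assume r: "r \<in> carrier (lie G)"
    show "\<exists>s\<in>carrier (lie G). s \<oplus>\<^bsub>lie G\<^esub> r = \<zero>\<^bsub>lie G\<^esub>"
      by (rule bexI[OF _ inv_closed[OF r]]) (simp add: sel val[OF r])
  qed (auto simp: sel add_closed zero_closed val G.m_ac)
  have "module class_ring (lie G)"
  proof (rule module.intro[OF _ ag])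
    show "cring (class_ring :: real ring)"
      using class_field by (auto simp: field_def domain_def)
    show "module_axioms (class_ring :: real ring) (lie G)"
      by unfold_locales
        (auto simp: sel smult_closed val_add distrib_right mult.assoc mult.left_commute)
  qed
  then show ?thesis
    using class_field by (auto simp: vectorspace_def)
qed

end

theory Submission
  imports Defs
begin

text \<open>
  Let \<open>n\<close> be the dimension of \<open>G\<close> and \<open>P\<close> the image of the exponential map, so that the claim is
  that \<open>\<Delta> \<inter> P\<close> is dense in \<open>\<Delta>\<close>.

  Reading the isomorphism between \<open>G / \<Delta>\<close> and the torus coordinatewise gives \<open>n\<close> continuous
  characters of \<open>G\<close> with values in the complex unit circle and common kernel \<open>\<Delta>\<close>. On a
  one-parameter subgroup of \<open>G\<close> each of them has the form \<open>t \<mapsto> cis (a * t)\<close>; the slopes \<open>a\<close>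
  define a linear map from the Lie algebra to the \<open>n\<close>-dimensional coordinate space. It is injective,
  because a one-parameter subgroup with all slopes zero is a connected subset of the totally
  disconnected group \<open>\<Delta>\<close>. Since both dimensions are \<open>n\<close>, it is surjective, so there are
  one-parameter subgroups \<open>r 0, \<dots>, r (n - 1)\<close> dual to the characters
  (\<open>dual_one_parameter_subgroups\<close>). The products of the points \<open>r i (t i)\<close>, where each \<open>t i\<close> ranges over
  \<open>[0, 2 * pi]\<close>, form a compact set \<open>K \<subseteq> P\<close> that meets every coset of \<open>\<Delta>\<close>
  (\<open>compact_fundamental_domain_in_exp_image\<close>).

  Let \<open>D\<close> be the closure of \<open>\<Delta> \<inter> P\<close>. Every element of \<open>P\<close> is the product of an element of
  \<open>\<Delta> \<inter> P\<close> and one of \<open>K\<close>, so the subgroup \<open>D P\<close> equals the compact set \<open>D K\<close>. It is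
  therefore a closed subgroup whose product with \<open>\<Delta>\<close> is \<open>G\<close>. The quotient of \<open>G\<close> by it
  is connected, and it is also a quotient of the profinite group \<open>\<Delta>\<close>; hence it is trivial
  (\<open>closed_subgroup_eq_carrier_if_profinite_supplement\<close>). Thus \<open>G = D K\<close>, and an element \<open>z k\<close> of
  \<open>\<Delta>\<close> with \<open>z \<in> D\<close> and \<open>k \<in> K\<close> has \<open>k \<in> \<Delta> \<inter> P \<subseteq> D\<close>, so that it lies in \<open>D\<close>.
  The second claim holds because \<open>\<Delta>\<close> is closed in \<open>G\<close>.
\<close>

section \<open>Topological abelian groups and profinite subgroups\<close>

context topological_abelian_group
begin

lemma compactin_set_mult:
  assumes "compactin (topo G) A" "compactin (topo G) B"
  shows "compactin (topo G) (A <#> B)"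
proof -
  have "A <#> B = (\<lambda>(x, y). x \<otimes> y) ` (A \<times> B)"
    by (auto simp: set_mult_def)
  then show ?thesis
    using assms by (simp add: image_compactin[OF _ continuous_mult] compactin_Times)
qed

lemma continuous_map_mult:
  assumes "continuous_map S (topo G) f" "continuous_map S (topo G) g"
  shows "continuous_map S (topo G) (\<lambda>x. f x \<otimes> g x)"
  using continuous_map_compose[OF _ continuous_mult, of S "\<lambda>x. (f x, g x)"] assms
  by (simp add: o_def continuous_map_paired)

lemma continuous_map_translation:
  assumes "a \<in> carrier G"
  shows "continuous_map (topo G) (topo G) (\<lambda>x. a \<otimes> x)"
  using assms by (intro continuous_map_mult) (auto simp: topspace_eq)

lemma subgroup_closure_of:
  assumes H: "subgroup H G"
  shows "subgroup (topo G closure_of H) G"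
proof (rule subgroup.intro)
  have sub: "H \<subseteq> topo G closure_of H"
    using H by (intro closure_of_subset) (simp add: topspace_eq subgroup.subset)
  show "topo G closure_of H \<subseteq> carrier G"
    using closure_of_subset_topspace[of "topo G" H] by (simp add: topspace_eq)
  show "\<one> \<in> topo G closure_of H"
    using sub H subgroup.one_closed by blast
  have "(\<lambda>(x, y). x \<otimes> y) ` (prod_topology (topo G) (topo G) closure_of (H \<times> H))
      \<subseteq> topo G closure_of ((\<lambda>(x, y). x \<otimes> y) ` (H \<times> H))"
    by (rule continuous_map_image_closure_subset[OF continuous_mult])
  also have "\<dots> \<subseteq> topo G closure_of H"
    using H by (intro closure_of_mono) (auto simp: subgroup.m_closed)
  finally show "x \<otimes> y \<in> topo G closure_of H"
    if "x \<in> topo G closure_of H" "y \<in> topo G closure_of H" for x y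
    using that by (auto simp: closure_of_Times)
  have "(\<lambda>x. inv x) ` (topo G closure_of H) \<subseteq> topo G closure_of ((\<lambda>x. inv x) ` H)"
    by (rule continuous_map_image_closure_subset[OF continuous_inv])
  also have "\<dots> \<subseteq> topo G closure_of H"
    using H by (intro closure_of_mono) (auto simp: subgroup.m_inv_closed)
  finally show "inv x \<in> topo G closure_of H" if "x \<in> topo G closure_of H" for x
    using that by auto
qed

text \<open>
  Both \<open>H\<close> and its complement are unions of cosets of \<open>H\<close>, and a coset contains the corresponding
  translate of \<open>U\<close> around each of its points.
\<close>

lemma clopen_subgroup_if_contains_neighborhood:
  assumes H: "subgroup H G" and U: "openin (topo G) U" "\<one> \<in> U" "U \<subseteq> H"
  shows "openin (topo G) H" "closedin (topo G) H"
proof -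
  have nbhd: "openin (topo G) {x \<in> carrier G. inv a \<otimes> x \<in> U}"
      "a \<in> {x \<in> carrier G. inv a \<otimes> x \<in> U}" if "a \<in> carrier G" for a
    using openin_continuous_map_preimage[OF continuous_map_translation U(1), of "inv a"] that U(2)
    by (auto simp: topspace_eq)
  have mem_iff: "x \<in> H \<longleftrightarrow> a \<in> H" if "a \<in> carrier G" "x \<in> carrier G" "inv a \<otimes> x \<in> H" for a x
  proof -
    have x: "a \<otimes> (inv a \<otimes> x) = x"
      using that by (simp flip: m_assoc)
    have a: "x \<otimes> inv (inv a \<otimes> x) = a"
      using that by (simp add: inv_mult m_lcomm[of x a])
    show ?thesis
      using subgroup.m_closed[OF H, of a "inv a \<otimes> x"] that(3)
        subgroup.m_closed[OF H, of x "inv (inv a \<otimes> x)"] subgroup.m_inv_closed[OF H that(3)]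
      unfolding x a by blast
  qed
  show "openin (topo G) H"
  proof (subst openin_subopen, intro ballI)
    fix a assume "a \<in> H"
    moreover have "a \<in> carrier G" using \<open>a \<in> H\<close> H subgroup.subset by blast
    ultimately show "\<exists>T. openin (topo G) T \<and> a \<in> T \<and> T \<subseteq> H"
      using nbhd[of a] mem_iff[of a] U(3) by (intro exI[of _ "{x \<in> carrier G. inv a \<otimes> x \<in> U}"]) blast
  qed
  have "openin (topo G) (carrier G - H)"
  proof (subst openin_subopen, intro ballI)
    fix a assume "a \<in> carrier G - H"
    then show "\<exists>T. openin (topo G) T \<and> a \<in> T \<and> T \<subseteq> carrier G - H"
      using nbhd[of a] mem_iff[of a] U(3) by (intro exI[of _ "{x \<in> carrier G. inv a \<otimes> x \<in> U}"]) blast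
  qed
  then show "closedin (topo G) H"
    using H by (simp add: closedin_def topspace_eq subgroup.subset)
qed

text \<open>
  The stabilizer of \<open>V\<close> under translation is the required subgroup: it lies in \<open>V\<close> because
  \<open>\<one> \<in> V\<close>, and it is open by the tube lemma, \<open>V\<close> being both compact and open.
\<close>

lemma open_subgroup_within_clopen:
  assumes compact: "compact_space (topo G)"
    and V: "openin (topo G) V" "closedin (topo G) V" "\<one> \<in> V"
  obtains U where "subgroup U G" "openin (topo G) U" "U \<subseteq> V"
proof -
  have Vsub: "V \<subseteq> carrier G"
    using openin_subset[OF V(1)] by (simp add: topspace_eq)
  define S where "S = {x \<in> carrier G. \<forall>v\<in>V. x \<otimes> v \<in> V}"
  define W where "W = {p \<in> topspace (prod_topology (topo G) (topo G)). (\<lambda>(x, y). x \<otimes> y) p \<in> V}"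
  have "openin (prod_topology (topo G) (topo G)) W"
    unfolding W_def by (rule openin_continuous_map_preimage[OF continuous_mult V(1)])
  moreover have "compactin (topo G) V"
    using closedin_compact_space[OF compact V(2)] .
  moreover have "{x} \<times> V \<subseteq> W" "x \<in> carrier G" if "x \<in> S" for x
    using that Vsub by (auto simp: S_def W_def topspace_eq)
  ultimately have "\<exists>A B. openin (topo G) A \<and> openin (topo G) B \<and> x \<in> A \<and> V \<subseteq> B \<and> A \<times> B \<subseteq> W"
    if "x \<in> S" for x
    using that by (intro tube_lemma_right) (simp_all add: topspace_eq)
  moreover have "A \<subseteq> S" if "openin (topo G) A" "V \<subseteq> B" "A \<times> B \<subseteq> W" for A B
  proof
    fix x assume "x \<in> A"
    then have "x \<in> carrier G" "(x, v) \<in> W" if "v \<in> V" for v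
      using openin_subset[OF \<open>openin (topo G) A\<close>] \<open>V \<subseteq> B\<close> \<open>A \<times> B \<subseteq> W\<close> that
      by (auto simp: topspace_eq)
    then show "x \<in> S"
      using V(3) by (auto simp: S_def W_def)
  qed
  ultimately have "\<exists>A. openin (topo G) A \<and> x \<in> A \<and> A \<subseteq> S" if "x \<in> S" for x
    using that by meson
  then have S: "openin (topo G) S"
    by (subst openin_subopen) blast
  define U where "U = S \<inter> {x \<in> carrier G. inv x \<in> S}"
  have "openin (topo G) U"
    unfolding U_def
    using S openin_continuous_map_preimage[OF continuous_inv S] by (auto simp: topspace_eq)
  moreover have "subgroup U G"
  proof (rule subgroup.intro)
    have mult: "x \<otimes> y \<in> S" if "x \<in> S" "y \<in> S" for x y
      using that subsetD[OF Vsub] by (simp add: S_def m_assoc)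
    show "U \<subseteq> carrier G"
      by (auto simp: U_def)
    have "\<one> \<in> S"
      using Vsub by (auto simp: S_def)
    then show "\<one> \<in> U"
      by (simp add: U_def)
    have SG: "x \<in> carrier G" if "x \<in> S" for x
      using that by (simp add: S_def)
    show "inv x \<in> U" if "x \<in> U" for x
      using that SG by (simp add: U_def)
    show "x \<otimes> y \<in> U" if "x \<in> U" "y \<in> U" for x y
      using that mult SG by (simp add: U_def inv_mult)
  qed
  moreover have "U \<subseteq> V"
  proof
    fix x assume "x \<in> U"
    then have "x \<in> carrier G" "x \<otimes> \<one> \<in> V"
      using V(3) unfolding U_def S_def by blast+
    then show "x \<in> V" by simp
  qed
  ultimately show thesis
    using that by blast
qed

end

text \<open>
  In a totally disconnected compact Hausdorff space a point can be separated by a clopen set from the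
  complement of any open neighbourhood, so the search for \<open>U\<close> can start from a clopen set.
\<close>

lemma (in profinite_group) open_subgroup_within_open:
  assumes W: "openin (topo G) W" "\<one> \<in> W"
  obtains U where "subgroup U G" "openin (topo G) U" "U \<subseteq> W"
proof -
  have "separated_between (topo G) {\<one>} (carrier G - W)"
  proof (rule cut_wire_fence_theorem_gen[OF compact])
    show "closedin (topo G) (carrier G - W)"
      using W(1) by (simp add: closedin_diff flip: topspace_eq)
    fix C assume C: "connectedin (topo G) C"
    show "disjnt C {\<one>} \<or> disjnt C (carrier G - W)"
    proof (cases "\<one> \<in> C")
      case True
      then have "C \<subseteq> connected_component_of_set (topo G) \<one>"
        using C by (simp add: connected_component_of_maximal)
      then show ?thesis
        using totally_disconnected[of \<one>] W(2) by (auto simp: disjnt_def)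
    qed auto
  qed (auto simp: Hausdorff topspace_eq)
  then obtain V where V: "closedin (topo G) V" "openin (topo G) V" "{\<one>} \<subseteq> V"
      "carrier G - W \<subseteq> topspace (topo G) - V"
    unfolding separated_between by blast
  then have "V \<subseteq> W"
    using openin_subset[OF V(2)] unfolding topspace_eq by blast
  obtain U where "subgroup U G" "openin (topo G) U" "U \<subseteq> V"
    using V by (auto intro: open_subgroup_within_clopen[OF compact, of V])
  then show thesis
    using that \<open>V \<subseteq> W\<close> by blast
qed

lemma subgroup_subgroup_space_iff:
  assumes "group G" "subgroup H G"
  shows "subgroup U (subgroup_space G H) \<longleftrightarrow> subgroup U G \<and> U \<subseteq> H"
proof -
  have "subgroup U (subgroup_space G H) \<longleftrightarrow> subgroup U (G\<lparr>carrier := H\<rparr>)"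
    by (simp add: subgroup_def m_inv_def subgroup_space_def)
  then show ?thesis
    using group.incl_subgroup[OF assms] group.subgroup_incl[OF assms(1) _ assms(2)]
      subgroup.subset[of U "G\<lparr>carrier := H\<rparr>"] by auto
qed

text \<open>
  The quotient of \<open>G\<close> by \<open>E\<close> is connected and also a quotient of \<open>\<Delta>\<close>. The proof shows it to be
  trivial without forming it: were \<open>d \<in> \<Delta>\<close> outside \<open>E\<close>, an open subgroup \<open>U\<close> of \<open>\<Delta>\<close> would exist
  with \<open>d U\<close> disjoint from \<open>E\<close>; but the subgroup \<open>U E\<close> is clopen, hence all of \<open>G\<close>, and writing
  \<open>d = u e\<close> puts \<open>d * inv u = e\<close> into both sets.
\<close>

lemma closed_subgroup_eq_carrier_if_profinite_supplement:
  fixes G :: "'a tgroup" (structure)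
  assumes G: "protorus G"
    and \<Delta>: "subgroup \<Delta> G" "profinite_group (subgroup_space G \<Delta>)"
    and E: "subgroup E G" "closedin (topo G) E"
    and cover: "\<Delta> <#> E = carrier G"
  shows "E = carrier G"
proof -
  interpret protorus G by fact
  interpret K: profinite_group "subgroup_space G \<Delta>" by fact
  let ?\<Delta> = "subtopology (topo G) \<Delta>"
  have K: "carrier (subgroup_space G \<Delta>) = \<Delta>" "topo (subgroup_space G \<Delta>) = ?\<Delta>"
    "\<one>\<^bsub>subgroup_space G \<Delta>\<^esub> = \<one>"
    by (simp_all add: subgroup_space_def)
  have \<Delta>_sub: "\<Delta> \<subseteq> carrier G" and E_sub: "E \<subseteq> carrier G"
    using \<Delta> E subgroup.subset by auto
  have E_compact: "compactin (topo G) E"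
    using closedin_compact_space[OF compact E(2)] .
  have "d \<in> E" if d: "d \<in> \<Delta>" for d
  proof (rule ccontr)
    assume "d \<notin> E"
    have dG: "d \<in> carrier G" using d \<Delta>_sub by auto
    define W where "W = {x \<in> carrier G. d \<otimes> x \<in> carrier G - E}"
    have "openin (topo G) (carrier G - E)"
      using E(2) by (simp add: closedin_def topspace_eq)
    then have "openin (topo G) W"
      unfolding W_def topspace_eq[symmetric]
      by (rule openin_continuous_map_preimage[OF continuous_map_translation[OF dG]])
    then have "openin ?\<Delta> (\<Delta> \<inter> W)"
      by (auto simp: openin_subtopology)
    moreover have "\<one> \<in> \<Delta> \<inter> W"
      using \<Delta>(1) subgroup.one_closed \<open>d \<notin> E\<close> dG by (auto simp: W_def)
    ultimately obtain U where U: "subgroup U (subgroup_space G \<Delta>)" "openin ?\<Delta> U" "U \<subseteq> \<Delta> \<inter> W"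
      using K.open_subgroup_within_open unfolding K by metis
    then have UG: "subgroup U G"
      using subgroup_subgroup_space_iff[OF is_group \<Delta>(1)] by simp
    define H where "H = U <#> E"
    have H: "subgroup H G"
      unfolding H_def by (rule mult_subgroups[OF UG E(1)])
    have "U <#> {\<one>} \<subseteq> H" "{\<one>} <#> E \<subseteq> H"
      unfolding H_def using UG E(1) by (intro mono_set_mult; simp add: subgroup.one_closed)+
    moreover have "U <#> {\<one>} = U" "{\<one>} <#> E = E"
      using subgroup.subset[OF UG] E_sub by (force simp: set_mult_def)+
    ultimately have U_H: "U \<subseteq> H" and E_H: "E \<subseteq> H"
      by simp_all
    have "subgroup (\<Delta> \<inter> H) (subgroup_space G \<Delta>)"
      using subgroup_subgroup_space_iff[OF is_group \<Delta>(1)] subgroups_Inter_pair[OF \<Delta>(1) H] by simp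
    then have clopen: "openin ?\<Delta> (\<Delta> \<inter> H)" "closedin ?\<Delta> (\<Delta> \<inter> H)"
      using K.clopen_subgroup_if_contains_neighborhood[of "\<Delta> \<inter> H" U] U U_H UG
      by (simp_all add: K subgroup.one_closed)
    moreover have "\<Delta> - H = topspace ?\<Delta> - (\<Delta> \<inter> H)"
      using \<Delta>_sub by (auto simp: topspace_eq)
    ultimately have "closedin ?\<Delta> (\<Delta> - H)"
      by (simp only: closedin_diff closedin_topspace)
    have mem_H_iff: "d \<otimes> e \<in> H \<longleftrightarrow> d \<in> H" if "d \<in> \<Delta>" "e \<in> E" for d e
    proof
      have cc: "d \<in> carrier G" "e \<in> carrier G" "e \<in> H" using that \<Delta>_sub E_sub E_H by auto
      assume "d \<otimes> e \<in> H"
      then have "d \<otimes> e \<otimes> inv e \<in> H"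
        using cc H by (meson subgroup.m_closed subgroup.m_inv_closed)
      then show "d \<in> H" using cc by (simp add: m_assoc)
    next
      assume "d \<in> H"
      then show "d \<otimes> e \<in> H"
        using that H E_H by (auto simp: subgroup.m_closed)
    qed
    have mem_cover: "x \<in> carrier G \<longleftrightarrow> (\<exists>d\<in>\<Delta>. \<exists>e\<in>E. x = d \<otimes> e)" for x
      unfolding cover[symmetric] by (simp add: set_mult_def)
    \<comment> \<open>Both \<open>H\<close> and its complement are products of compact sets, which makes \<open>H\<close> clopen.\<close>
    have H_eq: "H = (\<Delta> \<inter> H) <#> E"
    proof (rule Set.set_eqI)
      fix x
      have "x \<in> H \<Longrightarrow> x \<in> carrier G" using subgroup.subset[OF H] by blast
      then have "x \<in> H \<longleftrightarrow> (\<exists>d\<in>\<Delta> \<inter> H. \<exists>e\<in>E. x = d \<otimes> e)"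
        using mem_cover[of x] mem_H_iff by blast
      then show "x \<in> H \<longleftrightarrow> x \<in> (\<Delta> \<inter> H) <#> E" by (simp add: set_mult_def)
    qed
    have H_compl: "carrier G - H = (\<Delta> - H) <#> E"
    proof (rule Set.set_eqI)
      fix x
      have "x \<in> carrier G - H \<longleftrightarrow> (\<exists>d\<in>\<Delta> - H. \<exists>e\<in>E. x = d \<otimes> e)"
        using mem_cover[of x] mem_H_iff by blast
      then show "x \<in> carrier G - H \<longleftrightarrow> x \<in> (\<Delta> - H) <#> E" by (simp add: set_mult_def)
    qed
    have "compactin (topo G) (\<Delta> \<inter> H)" "compactin (topo G) (\<Delta> - H)"
      using closedin_compact_space[OF K.compact] clopen \<open>closedin ?\<Delta> (\<Delta> - H)\<close>
      by (auto simp: K compactin_subtopology)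
    then have "compactin (topo G) H" "compactin (topo G) (carrier G - H)"
      using compactin_set_mult[OF _ E_compact] by (simp_all only: H_compl) (subst H_eq, simp)
    then have "closedin (topo G) H" "closedin (topo G) (carrier G - H)"
      by (simp_all add: compactin_imp_closedin Hausdorff)
    then have "closedin (topo G) H" "openin (topo G) H"
      using subgroup.subset[OF H] by (simp_all add: openin_closedin_eq topspace_eq)
    then have "H = carrier G"
      using connected subgroup.one_closed[OF H] unfolding connected_space_clopen_in topspace_eq
      by blast
    then have "d \<in> U <#> E"
      using dG by (simp add: H_def)
    then obtain u e where ue: "u \<in> U" "e \<in> E" "d = u \<otimes> e"
      by (auto simp: set_mult_def)
    moreover have "u \<in> carrier G" "e \<in> carrier G"
      using ue U(3) \<Delta>_sub E_sub by auto
    ultimately have "d \<otimes> inv u = e"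
      by (simp add: m_comm[of u e] m_assoc)
    moreover have "inv u \<in> W"
      using subgroup.m_inv_closed[OF UG ue(1)] U(3) by auto
    ultimately show False
      using ue(2) by (simp add: W_def)
  qed
  then have "\<Delta> <#> E \<subseteq> E"
    using E(1) by (auto simp: set_mult_def subgroup.m_closed)
  then show ?thesis
    using cover E_sub by auto
qed

text \<open>
  With \<open>D\<close> the closure of \<open>\<Delta> \<inter> P\<close>, compactness of \<open>K\<close> is what makes \<open>D P = D K\<close> closed, so that
  the previous lemma yields \<open>D K = G\<close>.
\<close>

lemma closure_of_lattice_eq_if_compact_fundamental_domain:
  fixes G :: "'a tgroup" (structure)
  assumes G: "protorus G"
    and \<Delta>: "subgroup \<Delta> G" "profinite_group (subgroup_space G \<Delta>)"
    and P: "subgroup P G"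
    and K: "compactin (topo G) K" "K \<subseteq> P" "\<Delta> <#> K = carrier G"
  shows "topo G closure_of (\<Delta> \<inter> P) = \<Delta>"
proof -
  interpret protorus G by fact
  interpret profinite: profinite_group "subgroup_space G \<Delta>" by fact
  define D where "D = topo G closure_of (\<Delta> \<inter> P)"
  have \<Delta>_sub: "\<Delta> \<subseteq> carrier G" and P_sub: "P \<subseteq> carrier G"
    using \<Delta> P subgroup.subset by auto
  have "compactin (topo G) \<Delta>"
    using profinite.compact \<Delta>_sub by (simp add: subgroup_space_def compactin_subspace topspace_eq)
  then have "closedin (topo G) \<Delta>"
    by (simp add: compactin_imp_closedin Hausdorff)
  then have D_\<Delta>: "D \<subseteq> \<Delta>"
    unfolding D_def by (intro closure_of_minimal) auto
  have D: "subgroup D G"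
    unfolding D_def by (intro subgroup_closure_of subgroups_Inter_pair \<Delta> P)
  have D_sub: "D \<subseteq> carrier G" using D subgroup.subset by auto
  have sub_D: "\<Delta> \<inter> P \<subseteq> D"
    unfolding D_def using \<Delta>_sub by (intro closure_of_subset) (auto simp: topspace_eq)
  have K_sub: "K \<subseteq> carrier G"
    using K(2) P_sub by auto
  have "P \<subseteq> (\<Delta> \<inter> P) <#> K"
  proof
    fix x assume x: "x \<in> P"
    then have "x \<in> \<Delta> <#> K"
      using K(3) P_sub by auto
    then obtain k d where kd: "k \<in> K" "d \<in> \<Delta>" "x = d \<otimes> k"
      by (auto simp: set_mult_def)
    have "x \<otimes> inv k \<in> P"
      using x kd(1) K(2) P by (auto intro: subgroup.m_closed subgroup.m_inv_closed)
    moreover have "x \<otimes> inv k = d"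
      using subsetD[OF K_sub kd(1)] subsetD[OF \<Delta>_sub kd(2)]
      unfolding kd(3) by (simp add: m_assoc)
    ultimately show "x \<in> (\<Delta> \<inter> P) <#> K"
      using kd by (auto simp: set_mult_def)
  qed
  then have "D <#> P \<subseteq> D <#> ((\<Delta> \<inter> P) <#> K)"
    by (intro mono_set_mult) auto
  also have "\<dots> = D <#> (\<Delta> \<inter> P) <#> K"
    using K_sub \<Delta>_sub D_sub by (intro set_mult_assoc[symmetric]) auto
  also have "\<dots> \<subseteq> D <#> K"
    using sub_D D by (intro mono_set_mult) (auto simp: set_mult_def subgroup.m_closed)
  finally have DP: "D <#> P = D <#> K"
    using K(2) mono_set_mult[of D D K P] by auto
  have "compactin (topo G) D"
    unfolding D_def by (intro closedin_compact_space compact) simp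
  then have closed: "closedin (topo G) (D <#> P)"
    unfolding DP by (intro compactin_imp_closedin Hausdorff compactin_set_mult K(1))
  have "subgroup (D <#> P) G"
    by (intro mult_subgroups P D)
  moreover note closed
  moreover have "\<Delta> <#> (D <#> P) = carrier G"
  proof
    have "K \<subseteq> D <#> P"
    proof
      fix k assume k: "k \<in> K"
      then have "\<one> \<otimes> k \<in> D <#> P"
        using K(2) subgroup.one_closed[OF D]
        unfolding set_mult_def by (intro UN_I[of \<one>] UN_I[of k]) auto
      then show "k \<in> D <#> P"
        using subsetD[OF K_sub k] by simp
    qed
    then show "carrier G \<subseteq> \<Delta> <#> (D <#> P)"
      using mono_set_mult[of \<Delta> \<Delta> K "D <#> P" G] by (simp add: K(3))
    show "\<Delta> <#> (D <#> P) \<subseteq> carrier G"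
      by (intro set_mult_closed \<Delta>_sub P_sub D_sub)
  qed
  ultimately have "D <#> P = carrier G"
    by (rule closed_subgroup_eq_carrier_if_profinite_supplement[OF G \<Delta>])
  have "d \<in> D" if d: "d \<in> \<Delta>" for d
  proof -
    have "d \<in> D <#> K"
      using \<open>D <#> P = carrier G\<close> DP d \<Delta>_sub by auto
    then obtain z k where zk: "z \<in> D" "k \<in> K" "d = z \<otimes> k"
      by (auto simp: set_mult_def)
    have "k = inv z \<otimes> d"
      using subsetD[OF K_sub zk(2)] subsetD[OF D_sub zk(1)]
      unfolding zk(3) by (simp flip: m_assoc)
    also have "\<dots> \<in> \<Delta>"
      using subsetD[OF D_\<Delta> zk(1)] d \<Delta>(1)
      by (auto intro: subgroup.m_closed subgroup.m_inv_closed)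
    finally have "k \<in> D"
      using zk(2) K(2) sub_D by auto
    then show ?thesis
      unfolding zk(3) by (rule subgroup.m_closed[OF D zk(1)])
  qed
  then show ?thesis
    using D_\<Delta> unfolding D_def by auto
qed

section \<open>Characters of the real line\<close>

lemma continuous_additive_imp_linear:
  fixes f :: "real \<Rightarrow> real"
  assumes cont: "continuous_on UNIV f" and add: "\<And>x y. f (x + y) = f x + f y"
  shows "f x = x * f 1"
proof -
  have 0: "f 0 = 0"
    using add[of 0 0] by simp
  have minus: "f (- x) = - f x" for x
    using add[of x "- x"] 0 by simp
  have nat: "f (of_nat n * x) = of_nat n * f x" for n x
    by (induction n) (simp_all add: 0 add distrib_right)
  have int: "f (of_int k * x) = of_int k * f x" for k x
    by (cases k rule: int_cases2) (simp_all add: nat minus)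
  have rat: "f x = x * f 1" if "x \<in> \<rat>" for x
  proof -
    obtain a b :: int where "b > 0" "x = of_int a / of_int b"
      using \<open>x \<in> \<rat>\<close> by (rule Rats_cases') auto
    then have "of_int b * f x = of_int b * (x * f 1)"
      using int[of b x] int[of a 1] by simp
    then show ?thesis
      using \<open>b > 0\<close> by simp
  qed
  have "continuous_on (closure \<rat>) (\<lambda>x. f x - x * f 1)"
    using cont by (auto intro!: continuous_intros simp: Rats_closure_real)
  moreover have "f x - x * f 1 = 0" if "x \<in> \<rat>" for x
    using rat[OF that] by simp
  ultimately have "f x - x * f 1 = 0"
    by (rule continuous_constant_on_closure) (simp_all add: Rats_closure_real)
  then show ?thesis by simp
qed

text \<open>
  Since the real line is contractible, \<open>f\<close> has a continuous logarithm \<open>h\<close>, which can be normalized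
  by \<open>h 0 = 0\<close>. Its deviation from additivity is continuous with values in the multiples of
  \<open>2 * pi\<close>, hence constant, hence zero; and a continuous additive function is linear.
\<close>

lemma circle_valued_character:
  fixes f :: "real \<Rightarrow> complex"
  assumes cont: "continuous_on UNIV f"
    and norm: "\<And>x. norm (f x) = 1"
    and mult: "\<And>x y. f (x + y) = f x * f y"
  obtains a where "\<And>x. f x = cis (a * x)"
proof -
  have "f \<in> UNIV \<rightarrow> sphere 0 1"
    by (auto simp: norm)
  moreover have "Borsukian (UNIV :: real set)"
    by (intro contractible_imp_Borsukian contractible_UNIV)
  ultimately obtain g where "continuous_on UNIV (complex_of_real \<circ> g)"
      and fg: "\<And>x. f x = cis (g x)"
    using cont unfolding Borsukian_continuous_logarithm_circle_real cis_conv_exp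
    by blast
  then have "continuous_on UNIV (Re \<circ> (complex_of_real \<circ> g))"
    by (intro continuous_on_compose continuous_intros) auto
  then have g: "continuous_on UNIV g"
    by (simp add: o_def)
  define h where "h x = g x - g 0" for x
  have h: "continuous_on UNIV h"
    unfolding h_def by (intro continuous_intros g)
  have f0: "f 0 = 1"
    using mult[of 0 0] norm[of 0] by auto
  have fh: "f x = cis (h x)" for x
    using f0 by (simp add: h_def fg flip: cis_divide)
  have "h (x + y) = h x + h y" for x y
  proof -
    have "(\<lambda>x. h (x + y) - h x - h y) constant_on UNIV"
    proof (rule continuous_discrete_range_constant)
      show "connected (UNIV :: real set)" by simp
      show "continuous_on UNIV (\<lambda>x. h (x + y) - h x - h y)"
        by (intro continuous_intros continuous_on_compose2[OF h]) auto
      fix x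
      have *: "\<exists>k::int. h (x + y) - h x - h y = of_int k * (2 * pi)" for x
      proof -
        have "cis (h (x + y) - h x - h y) = 1"
          using mult[of x y] norm unfolding fh
          by (simp add: cis_mult cis_divide[symmetric])
        then have "cos (h (x + y) - h x - h y) = 1"
          by (simp add: complex_eq_iff)
        then show ?thesis
          unfolding cos_one_2pi_int by (auto simp: mult_ac)
      qed
      have "1 \<le> norm (h (x' + y) - h x' - h y - (h (x + y) - h x - h y))"
        if "h (x' + y) - h x' - h y \<noteq> h (x + y) - h x - h y" for x'
      proof -
        obtain k l :: int where kl: "h (x' + y) - h x' - h y = of_int k * (2 * pi)"
            "h (x + y) - h x - h y = of_int l * (2 * pi)"
          using * by meson
        then have "k \<noteq> l" using that by auto
        then have "1 \<le> \<bar>real_of_int (k - l)\<bar>" by linarith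
        moreover have "1 \<le> 2 * pi" using pi_gt3 by simp
        ultimately have "1 \<le> \<bar>real_of_int (k - l)\<bar> * (2 * pi)"
          using mult_mono[of 1 _ 1 "2*pi"] by simp
        then show ?thesis
          unfolding kl by (simp add: left_diff_distrib[symmetric] abs_mult)
      qed
      then show "\<exists>e>0. \<forall>x'. x' \<in> UNIV \<and> h (x' + y) - h x' - h y \<noteq> h (x + y) - h x - h y \<longrightarrow>
                e \<le> norm (h (x' + y) - h x' - h y - (h (x + y) - h x - h y))"
        by (intro exI[of _ 1]) auto
    qed
    then have "h (x + y) - h x - h y = h (0 + y) - h 0 - h y"
      unfolding constant_on_def by (metis UNIV_I)
    then show ?thesis by (simp add: h_def)
  qed
  with h have hx: "h x = x * h 1" for x
    by (rule continuous_additive_imp_linear)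
  have "f x = cis (h 1 * x)" for x
    using fh[of x] hx[of x] by (simp add: mult.commute)
  then show thesis
    by (rule that)
qed

lemma cis_slope_unique:
  assumes "\<And>t. cis (a * t) = cis (b * t)"
  shows "a = b"
proof (rule ccontr)
  assume "a \<noteq> b"
  have "cis ((a - b) * (pi / (a - b))) = 1"
    using assms[of "pi / (a - b)"] by (simp add: left_diff_distrib diff_divide_distrib flip: cis_divide)
  with \<open>a \<noteq> b\<close> show False
    by simp
qed

section \<open>The circle as a group of complex numbers\<close>

lemma comm_group_real_line: "comm_group real_line"
proof (rule comm_groupI)
  show "\<exists>y\<in>carrier real_line. y \<otimes>\<^bsub>real_line\<^esub> x = \<one>\<^bsub>real_line\<^esub>" for x
    by (rule bexI[of _ "- x"]) (simp_all add: real_line_def)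
qed (simp_all add: real_line_def)

lemma inv_real_line: "inv\<^bsub>real_line\<^esub> x = - x"
proof -
  interpret comm_group real_line by (rule comm_group_real_line)
  show ?thesis
    by (rule inv_equality) (simp_all add: real_line_def)
qed

lemma topological_abelian_group_real_line: "topological_abelian_group real_line"
proof -
  interpret comm_group real_line by (rule comm_group_real_line)
  show ?thesis
  proof unfold_locales
    have "continuous_map (prod_topology euclideanreal euclideanreal) euclideanreal (\<lambda>(x, y). x + y)"
      unfolding case_prod_unfold
      by (intro continuous_map_add continuous_map_fst continuous_map_snd)
    then show "continuous_map (prod_topology (topo real_line) (topo real_line)) (topo real_line)
        (\<lambda>(x, y). x \<otimes>\<^bsub>real_line\<^esub> y)"
      by (simp add: real_line_def)
    show "continuous_map (topo real_line) (topo real_line) (\<lambda>x. inv\<^bsub>real_line\<^esub> x)"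
      unfolding inv_real_line by (simp add: real_line_def continuous_on_minus)
  qed (simp_all add: real_line_def)
qed

lemma quotient_space_sel [simp]:
  "carrier (quotient_space G H) = rcosets\<^bsub>G\<^esub> H"
  "monoid.mult (quotient_space G H) = set_mult G"
  "topo (quotient_space G H) = quotient_topology G H"
  by (simp_all add: quotient_space_def monoid.defs tgroup.defs FactGroup_def)

lemma power_space_sel [simp]:
  "carrier (power_space G n) = (\<Pi>\<^sub>E i\<in>{..<n}. carrier G)"
  "monoid.mult (power_space G n) = (\<lambda>x y. \<lambda>i\<in>{..<n}. x i \<otimes>\<^bsub>G\<^esub> y i)"
  "topo (power_space G n) = product_topology (\<lambda>_. topo G) {..<n}"
  by (simp_all add: power_space_def monoid.defs tgroup.defs product_group_def)

text \<open>
  The embedding of the real numbers modulo \<open>1\<close> into the complex numbers. Its points are cosets of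
  the integers, and the value does not depend on the representative that is chosen.
\<close>

definition circle_to_complex :: "real set \<Rightarrow> complex"
  where "circle_to_complex C = cis (2 * pi * (SOME x. x \<in> C))"

lemma real_line_coset: "\<int> #>\<^bsub>real_line\<^esub> x = (\<lambda>k. k + x) ` \<int>"
  by (auto simp: r_coset_def real_line_def)

lemma circle_to_complex_coset: "circle_to_complex (\<int> #>\<^bsub>real_line\<^esub> x) = cis (2 * pi * x)"
proof -
  have "x \<in> \<int> #>\<^bsub>real_line\<^esub> x"
    by (auto simp: real_line_coset image_iff)
  then have "(SOME y. y \<in> \<int> #>\<^bsub>real_line\<^esub> x) \<in> \<int> #>\<^bsub>real_line\<^esub> x"
    by (rule someI)
  then obtain k where "(SOME y. y \<in> \<int> #>\<^bsub>real_line\<^esub> x) = of_int k + x"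
    unfolding real_line_coset by (auto elim!: Ints_cases)
  then show ?thesis
    by (simp add: circle_to_complex_def distrib_left cis_multiple_2pi flip: cis_mult)
qed

lemma carrier_circle: "carrier circle = range (\<lambda>x. \<int> #>\<^bsub>real_line\<^esub> x)"
  by (auto simp: circle_def RCOSETS_def real_line_def)

lemma circle_to_complex:
  shows continuous_map_circle_to_complex: "continuous_map (topo circle) euclidean circle_to_complex"
    and norm_circle_to_complex: "norm (circle_to_complex C) = 1"
    and circle_to_complex_mult: "C \<in> carrier circle \<Longrightarrow> D \<in> carrier circle \<Longrightarrow>
          circle_to_complex (C \<otimes>\<^bsub>circle\<^esub> D) = circle_to_complex C * circle_to_complex D"
    and circle_to_complex_eq_iff: "C \<in> carrier circle \<Longrightarrow> D \<in> carrier circle \<Longrightarrow>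
          circle_to_complex C = circle_to_complex D \<longleftrightarrow> C = D"
proof -
  have "continuous_map (topo real_line) euclidean (circle_to_complex \<circ> (\<lambda>x. \<int> #>\<^bsub>real_line\<^esub> x))"
    unfolding o_def circle_to_complex_coset
    by (auto simp: real_line_def intro!: continuous_intros)
  then show "continuous_map (topo circle) euclidean circle_to_complex"
    using continuous_compose_quotient_map[OF quotient_map_quotient_topology[OF topological_abelian_group_real_line]]
    by (simp add: circle_def)
  show "norm (circle_to_complex C) = 1"
    by (simp add: circle_to_complex_def)
  assume C: "C \<in> carrier circle" and D: "D \<in> carrier circle"
  then obtain x y where xy: "C = \<int> #>\<^bsub>real_line\<^esub> x" "D = \<int> #>\<^bsub>real_line\<^esub> y"
    by (auto simp: carrier_circle)
  interpret topological_abelian_group real_line by (rule topological_abelian_group_real_line)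
  have real: "carrier real_line = UNIV" "monoid.mult real_line = (+)"
    by (simp_all add: real_line_def)
  have subgroup: "subgroup \<int> real_line"
    by (rule subgroupI) (auto simp: real inv_real_line)
  then interpret normal \<int> real_line
    by (rule normal_iff_subgroup[THEN iffD2])
  have "C \<otimes>\<^bsub>circle\<^esub> D = \<int> #>\<^bsub>real_line\<^esub> (x + y)"
    using rcos_sum[of x y] by (simp add: xy circle_def real)
  then show "circle_to_complex (C \<otimes>\<^bsub>circle\<^esub> D) = circle_to_complex C * circle_to_complex D"
    by (simp add: xy circle_to_complex_coset distrib_left cis_mult)
  have "C = D" if "circle_to_complex C = circle_to_complex D"
  proof -
    have "cis (2 * pi * (x - y)) = 1"
      using that by (simp add: xy circle_to_complex_coset right_diff_distrib flip: cis_divide)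
    then have "cos (2 * pi * (x - y)) = 1"
      by (simp add: complex_eq_iff)
    then obtain k :: int where "2 * pi * (x - y) = of_int k * 2 * pi"
      unfolding cos_one_2pi_int by auto
    then have "x - y = of_int k" by simp
    then have "x = of_int k + y" by simp
    then have "x \<in> \<int> #>\<^bsub>real_line\<^esub> y"
      by (simp add: real_line_coset)
    then show "C = D"
      unfolding xy using subgroup repr_independence[of x \<int> y] by (simp add: real)
  qed
  then show "circle_to_complex C = circle_to_complex D \<longleftrightarrow> C = D"
    by auto
qed

section \<open>One-parameter subgroups and the exponential image\<close>

lemma carrier_lie_iff:
  "r \<in> carrier (lie G) \<longleftrightarrow> (\<forall>t. r t \<in> carrier G) \<and>
     (\<forall>s t. r (s + t) = r s \<otimes>\<^bsub>G\<^esub> r t) \<and> continuous_map euclideanreal (topo G) r"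
  by (auto simp: lie_def hom_def real_line_def)

lemma lie_sel [simp]:
  "ring.zero (lie G) = (\<lambda>t. \<one>\<^bsub>G\<^esub>)"
  "ring.add (lie G) = (\<lambda>r s t. r t \<otimes>\<^bsub>G\<^esub> s t)"
  "module.smult (lie G) = (\<lambda>a r t. r (a * t))"
  by (simp_all add: lie_def)

lemma exp_imageI: "r \<in> carrier (lie G) \<Longrightarrow> r 1 \<in> exp_image G"
  by (auto simp: lie_exp_def)

lemma subgroup_exp_image:
  fixes G :: "'a tgroup"
  assumes "topological_abelian_group G"
  shows "subgroup (exp_image G) G"
proof -
  interpret topological_abelian_group G by fact
  interpret V: vectorspace class_ring "lie G"
    by (rule vectorspace_lie[OF assms])
  show ?thesis
  proof (rule subgroupI)
    show "exp_image G \<subseteq> carrier G"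
      by (auto simp: lie_exp_def carrier_lie_iff)
    show "exp_image G \<noteq> {}"
      using exp_imageI[OF V.zero_closed] by blast
    fix x assume "x \<in> exp_image G"
    then obtain r where r: "r \<in> carrier (lie G)" "x = r 1"
      by (auto simp: lie_exp_def)
    have "r (- 1) \<otimes>\<^bsub>G\<^esub> r 1 \<otimes>\<^bsub>G\<^esub> r 0 = r 0"
      using r(1) unfolding carrier_lie_iff by (metis add.right_neutral add.left_inverse)
    then have "r (- 1) \<otimes>\<^bsub>G\<^esub> r 1 = \<one>\<^bsub>G\<^esub>"
      using r(1) by (simp add: carrier_lie_iff)
    then have "inv\<^bsub>G\<^esub> x = r (- 1)"
      using r by (intro inv_equality) (simp_all add: carrier_lie_iff)
    moreover have "r (- 1) \<in> exp_image G"
      using exp_imageI[OF V.smult_closed[OF _ r(1), of "- 1"]] by simp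
    ultimately show "inv\<^bsub>G\<^esub> x \<in> exp_image G" by simp
    fix y assume "y \<in> exp_image G"
    then obtain s where s: "s \<in> carrier (lie G)" "y = s 1"
      by (auto simp: lie_exp_def)
    show "x \<otimes>\<^bsub>G\<^esub> y \<in> exp_image G"
      using exp_imageI[OF V.add.m_closed[OF r(1) s(1)]] by (simp add: r(2) s(2))
  qed
qed

section \<open>One-parameter subgroups dual to a family of characters\<close>

text \<open>
  A dimension count: the image of a basis of \<open>V\<close> is linearly independent and has as many elements as
  the dimension of the target.
\<close>

lemma injective_linear_map_onto_coordinates:
  fixes V :: "(real, 'v) module"
  assumes V: "vectorspace class_ring V" and fd: "vectorspace.fin_dim class_ring V"
    and n: "vectorspace.dim class_ring V = n"
    and into: "\<And>v. v \<in> carrier V \<Longrightarrow> T v \<in> carrier_vec n"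
    and add: "\<And>v w. v \<in> carrier V \<Longrightarrow> w \<in> carrier V \<Longrightarrow> T (v \<oplus>\<^bsub>V\<^esub> w) = T v + T w"
    and smult: "\<And>a v. v \<in> carrier V \<Longrightarrow> T (a \<odot>\<^bsub>V\<^esub> v) = a \<cdot>\<^sub>v T v"
    and inj: "\<And>v. v \<in> carrier V \<Longrightarrow> T v = 0\<^sub>v n \<Longrightarrow> v = \<zero>\<^bsub>V\<^esub>"
  shows "T ` carrier V = carrier_vec n"
proof -
  define W where "W = module_vec TYPE(real) n"
  interpret V: vectorspace class_ring V by fact
  interpret W: vec_space "TYPE(real)" n .
  have W: "vectorspace class_ring W"
    unfolding W_def by (rule vec_vs)
  have Wsel: "carrier W = carrier_vec n" "ring.add W = (+)" "ring.zero W = 0\<^sub>v n" "module.smult W = (\<cdot>\<^sub>v)"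
    by (simp_all add: W_def module_vec_simps)
  interpret W': vectorspace class_ring W by (rule W)
  interpret T: linear_map class_ring V W T
    using V W add smult into
    by (auto simp: linear_map_def mod_hom_def mod_hom_axioms_def module_hom_def Wsel vectorspace_def)
  have "carrier (V.vs T.kerT) = {\<zero>\<^bsub>V\<^esub>}"
    using inj T.f0_is_0 by (auto simp: T.ker_def Wsel)
  then have injT: "inj_on T (carrier V)"
    by (rule T.Ke0_imp_inj)
  have sub: "subspace class_ring T.imT W" by (rule T.imT_is_subspace)
  have Im: "vectorspace class_ring (W'.vs T.imT)"
    by (rule W'.subspace_is_vs[OF sub])
  interpret Im: vectorspace class_ring "W'.vs T.imT" by (rule Im)
  interpret T': linear_map class_ring V "W'.vs T.imT" T
    using V Im T.T_add T.T_smult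
    by (auto simp: linear_map_def mod_hom_def mod_hom_axioms_def module_hom_def vectorspace_def T.im_def)
  obtain B where B: "V.basis B" "finite B"
    using V.finite_basis_exists[OF fd] by auto
  have surj: "T ` carrier V = carrier (W'.vs T.imT)"
    by (simp add: T.im_def)
  have TB: "Im.basis (T ` B)"
    by (rule T'.linear_inj_image_is_basis[OF injT surj B(1) fd])
  have sub_im: "T ` B \<subseteq> T.imT"
    using B(1) by (auto simp: V.basis_def T.im_def)
  have "submodule class_ring T.imT W"
    using sub by (simp add: subspace_def)
  then have li: "W'.lin_indpt (T ` B)"
    using W'.span_li_not_depend(2)[OF sub_im] TB by (simp add: Im.basis_def)
  have card: "card (T ` B) = n"
    using injT B V.dim_basis[of B] n by (subst card_image) (auto simp: V.basis_def intro: inj_on_subset)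
  have "W'.basis (T ` B)"
  proof (rule W'.dim_li_is_basis)
    show "W'.fin_dim" "W'.dim \<le> card (T ` B)"
      using W.fin_dim W.dim_is_n by (simp_all add: W_def card)
    show "finite (T ` B)" "T ` B \<subseteq> carrier W"
      using B into by (auto simp: V.basis_def Wsel)
  qed (rule li)
  then have "carrier W = W'.span (T ` B)"
    by (simp add: W'.basis_def)
  also have "\<dots> \<subseteq> T.imT"
    using sub sub_im by (intro W'.span_is_subset) (auto simp: subspace_def)
  finally show ?thesis
    using into by (auto simp: Wsel T.im_def)
qed

text \<open>
  The last assumption says that the common kernel of the characters is contained in \<open>\<Delta>\<close>, in the form
  in which it is used: points on which all characters agree differ by an element of \<open>\<Delta>\<close>.
\<close>

locale kernel_of_circle_characters = topological_abelian_group G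
  for G :: "'a tgroup" (structure) +
  fixes \<Delta> :: "'a set" and n :: nat and \<phi> :: "nat \<Rightarrow> 'a \<Rightarrow> complex"
  assumes kernel_subgroup: "subgroup \<Delta> G"
    and continuous_character: "i < n \<Longrightarrow> continuous_map (topo G) euclidean (\<phi> i)"
    and norm_character: "norm (\<phi> i x) = 1"
    and character_mult: "i < n \<Longrightarrow> x \<in> carrier G \<Longrightarrow> y \<in> carrier G \<Longrightarrow> \<phi> i (x \<otimes> y) = \<phi> i x * \<phi> i y"
    and kernel: "x \<in> carrier G \<Longrightarrow> y \<in> carrier G \<Longrightarrow> (\<And>i. i < n \<Longrightarrow> \<phi> i x = \<phi> i y) \<Longrightarrow> x \<otimes> inv y \<in> \<Delta>"

text \<open>
  The characters are the coordinates of the quotient map followed by the embedding of the circle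
  into the complex numbers.
\<close>

lemma kernel_of_circle_characters_if_torus_quotient:
  fixes G :: "'a tgroup"
  assumes G: "topological_abelian_group G" and \<Delta>: "subgroup \<Delta> G"
    and iso: "quotient_space G \<Delta> \<cong>\<^sub>t torus n"
  obtains \<phi> where "kernel_of_circle_characters G \<Delta> n \<phi>"
proof -
  interpret topological_abelian_group G by fact
  interpret normal \<Delta> G
    using \<Delta> by (rule normal_iff_subgroup[THEN iffD2])
  obtain f where f: "f \<in> iso (quotient_space G \<Delta>) (torus n)"
      "homeomorphic_map (quotient_topology G \<Delta>) (product_topology (\<lambda>_. topo circle) {..<n}) f"
    using iso by (auto simp: top_iso_def)
  have f_hom: "f (C <#>\<^bsub>G\<^esub> D) = (\<lambda>i\<in>{..<n}. f C i \<otimes>\<^bsub>circle\<^esub> f D i)"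
    if "C \<in> rcosets\<^bsub>G\<^esub> \<Delta>" "D \<in> rcosets\<^bsub>G\<^esub> \<Delta>" for C D
    using f(1) that by (simp add: iso_def hom_def)
  have f_in: "f C \<in> (\<Pi>\<^sub>E i\<in>{..<n}. carrier circle)" if "C \<in> rcosets\<^bsub>G\<^esub> \<Delta>" for C
    using f(1) that by (auto simp: iso_def hom_def)
  have f_inj: "inj_on f (rcosets\<^bsub>G\<^esub> \<Delta>)"
    using f(1) by (simp add: iso_def bij_betw_def)
  have coset: "\<Delta> #>\<^bsub>G\<^esub> x \<in> rcosets\<^bsub>G\<^esub> \<Delta>" if "x \<in> carrier G" for x
    using that subset by (rule rcosetsI[rotated])
  have comp_in: "f (\<Delta> #>\<^bsub>G\<^esub> x) i \<in> carrier circle" if "x \<in> carrier G" "i < n" for x i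
    using f_in[OF coset[OF that(1)]] that(2) by (auto simp: PiE_iff)
  define \<phi> where "\<phi> i x = circle_to_complex (f (\<Delta> #>\<^bsub>G\<^esub> x) i)" for i x
  have "kernel_of_circle_characters G \<Delta> n \<phi>"
  proof unfold_locales
    show "norm (\<phi> i x) = 1" for i x
      by (simp add: \<phi>_def norm_circle_to_complex)
    fix i assume i: "i < n"
    have "continuous_map (topo G) (quotient_topology G \<Delta>) (\<lambda>x. \<Delta> #>\<^bsub>G\<^esub> x)"
      by (intro quotient_imp_continuous_map quotient_map_quotient_topology G)
    moreover have "continuous_map (quotient_topology G \<Delta>) (topo circle) (\<lambda>C. f C i)"
      using continuous_map_product_then_coordinatewise(1)[OF homeomorphic_imp_continuous_map[OF f(2)]] i by simp
    ultimately have "continuous_map (topo G) euclidean (circle_to_complex \<circ> ((\<lambda>C. f C i) \<circ> (\<lambda>x. \<Delta> #>\<^bsub>G\<^esub> x)))"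
      by (intro continuous_map_compose[OF _ continuous_map_circle_to_complex]) (rule continuous_map_compose)
    then show "continuous_map (topo G) euclidean (\<phi> i)"
      by (simp add: o_def \<phi>_def[abs_def])
    show "\<phi> i (x \<otimes>\<^bsub>G\<^esub> y) = \<phi> i x * \<phi> i y" if "x \<in> carrier G" "y \<in> carrier G" for x y
      using that i f_hom[OF coset coset, of x y] comp_in
      by (simp add: \<phi>_def rcos_sum circle_to_complex_mult)
  next
    fix x y assume xy: "x \<in> carrier G" "y \<in> carrier G" and eq: "\<And>i. i < n \<Longrightarrow> \<phi> i x = \<phi> i y"
    have "f (\<Delta> #>\<^bsub>G\<^esub> x) = f (\<Delta> #>\<^bsub>G\<^esub> y)"
      using f_in[OF coset[OF xy(1)]] f_in[OF coset[OF xy(2)]] eq comp_in xy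
      by (intro PiE_ext[of _ "{..<n}"]) (auto simp: \<phi>_def circle_to_complex_eq_iff)
    then have "\<Delta> #>\<^bsub>G\<^esub> x = \<Delta> #>\<^bsub>G\<^esub> y"
      using f_inj coset xy by (auto dest: inj_onD)
    then have "x \<in> \<Delta> #>\<^bsub>G\<^esub> y"
      using rcos_self[OF xy(1) \<Delta>] by simp
    then obtain h where "h \<in> \<Delta>" "x = h \<otimes>\<^bsub>G\<^esub> y"
      by (auto simp: r_coset_def)
    then show "x \<otimes>\<^bsub>G\<^esub> inv\<^bsub>G\<^esub> y \<in> \<Delta>"
      using xy subset by (auto simp: m_assoc)
  qed
  then show thesis by (rule that)
qed

context kernel_of_circle_characters
begin

lemma character_one: "i < n \<Longrightarrow> \<phi> i \<one> = 1"
  using character_mult[of i \<one> \<one>] norm_character[of i \<one>] by auto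

text \<open>
  The derivative of \<open>\<phi> i\<close> along \<open>r\<close> at \<open>0\<close>, divided by \<open>\<i>\<close>. For \<open>i < n\<close> and \<open>r\<close> in the Lie algebra
  it is meaningful, because every continuous homomorphism from the real line to the unit circle is
  \<open>t \<mapsto> cis (a * t)\<close> for a unique \<open>a\<close>.
\<close>

definition slope :: "nat \<Rightarrow> (real \<Rightarrow> 'a) \<Rightarrow> real"
  where "slope i r = (THE a. \<forall>t. \<phi> i (r t) = cis (a * t))"

lemma slope_eqI:
  assumes "\<And>t. \<phi> i (r t) = cis (a * t)"
  shows "slope i r = a"
  unfolding slope_def
proof (rule the_equality)
  show "b = a" if "\<forall>t. \<phi> i (r t) = cis (b * t)" for b
    using that assms by (intro cis_slope_unique) simp
qed (simp add: assms)

lemma character_one_parameter: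
  assumes "i < n" "r \<in> carrier (lie G)"
  shows "\<phi> i (r t) = cis (slope i r * t)"
proof -
  have "continuous_map euclideanreal euclidean (\<phi> i \<circ> r)"
    using assms by (intro continuous_map_compose[OF _ continuous_character]) (simp_all add: carrier_lie_iff)
  then have "continuous_on UNIV (\<lambda>t. \<phi> i (r t))"
    by (simp add: o_def)
  then obtain a where a: "\<And>t. \<phi> i (r t) = cis (a * t)"
    by (rule circle_valued_character)
      (use assms in \<open>auto simp: norm_character carrier_lie_iff character_mult\<close>)
  then show ?thesis
    by (simp add: slope_eqI)
qed

text \<open>
  Such an \<open>r\<close> takes its values in the common kernel of the characters, hence in \<open>\<Delta>\<close>, where every
  connected subset is at most a point.
\<close>

lemma one_parameter_trivial_if_slopes_zero:
  assumes \<Delta>: "profinite_group (subgroup_space G \<Delta>)"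
    and r: "r \<in> carrier (lie G)" and zero: "\<And>i. i < n \<Longrightarrow> slope i r = 0"
  shows "r = (\<lambda>t. \<one>)"
proof
  fix t
  interpret D: profinite_group "subgroup_space G \<Delta>" by fact
  have "r u \<otimes> inv \<one> \<in> \<Delta>" for u
    using r zero by (intro kernel) (auto simp: carrier_lie_iff character_one_parameter character_one)
  then have in_\<Delta>: "r u \<in> \<Delta>" for u
    using r by (simp add: carrier_lie_iff)
  have r0: "r 0 = \<one>"
  proof -
    have "r 0 \<otimes> r 0 = r 0" "r 0 \<in> carrier G"
      using r unfolding carrier_lie_iff by (metis add_0, blast)
    then show ?thesis by simp
  qed
  have "continuous_map euclideanreal (subtopology (topo G) \<Delta>) r"
    using r in_\<Delta> by (auto simp: carrier_lie_iff continuous_map_in_subtopology)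
  then have "connectedin (subtopology (topo G) \<Delta>) (r ` UNIV)"
    by (rule connectedin_continuous_map_image) simp
  then have "r ` UNIV \<subseteq> connected_component_of_set (subtopology (topo G) \<Delta>) \<one>"
    by (rule connected_component_of_maximal) (metis r0 rangeI)
  also have "\<dots> = {\<one>}"
    using D.totally_disconnected[of \<one>] kernel_subgroup
    by (simp add: subgroup_space_def subgroup.one_closed)
  finally show "r t = \<one>" by auto
qed

text \<open>
  The linear map that sends a one-parameter subgroup to its slopes is injective, hence bijective, and
  the \<open>r i\<close> are the preimages of the unit vectors. This is where the dimension of \<open>G\<close> has to agree
  with that of the torus.
\<close>

lemma dual_one_parameter_subgroups:
  assumes \<Delta>: "profinite_group (subgroup_space G \<Delta>)"
    and "finite_dimensional G" and n: "group_dim G = n"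
  obtains r where "\<And>i. i < n \<Longrightarrow> r i \<in> carrier (lie G)"
    and "\<And>i j t. i < n \<Longrightarrow> j < n \<Longrightarrow> \<phi> j (r i t) = (if i = j then cis t else 1)"
proof -
  define T where "T r = vec n (\<lambda>i. slope i r)" for r
  have "T ` carrier (lie G) = carrier_vec n"
  proof (rule injective_linear_map_onto_coordinates)
    show "vectorspace class_ring (lie G)"
      by (intro vectorspace_lie) unfold_locales
    show "vectorspace.fin_dim class_ring (lie G)" "vectorspace.dim class_ring (lie G) = n"
      using assms by (auto simp: finite_dimensional_def group_dim_def)
    show "T r \<in> carrier_vec n" for r
      by (simp add: T_def)
    fix r assume r: "r \<in> carrier (lie G)"
    show "T (r \<oplus>\<^bsub>lie G\<^esub> s) = T r + T s" if s: "s \<in> carrier (lie G)" for s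
    proof (rule eq_vecI)
      fix i assume "i < dim_vec (T r + T s)"
      then have i: "i < n" by (simp add: T_def)
      then have "\<phi> i (r t \<otimes> s t) = cis ((slope i r + slope i s) * t)" for t
        using r s by (simp add: character_mult carrier_lie_iff distrib_right flip: cis_mult)
          (simp add: character_one_parameter carrier_lie_iff)
      then have "slope i (\<lambda>t. r t \<otimes> s t) = slope i r + slope i s"
        by (rule slope_eqI)
      then show "T (r \<oplus>\<^bsub>lie G\<^esub> s) $ i = (T r + T s) $ i"
        using i by (simp add: T_def)
    qed (simp add: T_def)
    show "T (a \<odot>\<^bsub>lie G\<^esub> r) = a \<cdot>\<^sub>v T r" for a
    proof (rule eq_vecI)
      fix i assume "i < dim_vec (a \<cdot>\<^sub>v T r)"
      then have i: "i < n" by (simp add: T_def)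
      have "slope i (\<lambda>t. r (a * t)) = a * slope i r"
        using i r by (intro slope_eqI) (simp add: character_one_parameter mult_ac)
      then show "T (a \<odot>\<^bsub>lie G\<^esub> r) $ i = (a \<cdot>\<^sub>v T r) $ i"
        using i by (simp add: T_def)
    qed (simp add: T_def)
    show "r = \<zero>\<^bsub>lie G\<^esub>" if "T r = 0\<^sub>v n"
    proof -
      have "slope i r = 0" if "i < n" for i
        using arg_cong[OF \<open>T r = 0\<^sub>v n\<close>, of "\<lambda>v. v $ i"] that by (simp add: T_def)
      then show ?thesis
        using one_parameter_trivial_if_slopes_zero[OF \<Delta> r] by simp
    qed
  qed
  then have "\<exists>r. r \<in> carrier (lie G) \<and> T r = unit_vec n i" for i
    using unit_vec_carrier[of n i] by (metis imageE)
  then obtain r where r: "\<And>i. r i \<in> carrier (lie G)" "\<And>i. T (r i) = unit_vec n i"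
    by metis
  have "slope j (r i) = (if i = j then 1 else 0)" if "i < n" "j < n" for i j
    using arg_cong[OF r(2)[of i], of "\<lambda>v. v $ j"] that by (simp add: T_def)
  then have "\<phi> j (r i t) = (if i = j then cis t else 1)" if "i < n" "j < n" for i j t
    using that r(1) by (simp add: character_one_parameter)
  then show thesis
    by (rule that[OF r(1)])
qed

end

text \<open>
  \<open>K\<close> is the product of the compact arcs \<open>r i ` {0..2 * pi}\<close>. By duality the \<open>i\<close>-th arc adjusts the
  value of the \<open>i\<close>-th character to any unit complex number and leaves the other values alone, so
  every point of \<open>G\<close> agrees with some point of \<open>K\<close> on all characters.
\<close>

lemma (in kernel_of_circle_characters) compact_fundamental_domain_in_exp_image:
  assumes r: "\<And>i. i < n \<Longrightarrow> r i \<in> carrier (lie G)"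
    and dual: "\<And>i j t. i < n \<Longrightarrow> j < n \<Longrightarrow> \<phi> j (r i t) = (if i = j then cis t else 1)"
  obtains K where "compactin (topo G) K" "K \<subseteq> exp_image G" "\<Delta> <#> K = carrier G"
proof -
  have P: "subgroup (exp_image G) G"
    by (intro subgroup_exp_image) unfold_locales
  interpret V: vectorspace class_ring "lie G"
    by (intro vectorspace_lie) unfold_locales
  have r_exp: "r i t \<in> exp_image G" if "i < n" for i t
  proof -
    have "(\<lambda>u. r i (t * u)) \<in> carrier (lie G)"
      using V.smult_closed[OF _ r[OF that], of t] by simp
    from exp_imageI[OF this] show ?thesis
      by simp
  qed
  \<comment> \<open>Induction on the number \<open>m\<close> of arcs that have been multiplied so far.\<close>
  have "\<exists>K. compactin (topo G) K \<and> K \<subseteq> exp_image G \<and>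
      (\<forall>z. (\<forall>i<n. norm (z i) = 1) \<longrightarrow> (\<exists>k\<in>K. \<forall>i<n. \<phi> i k = (if i < m then z i else 1)))"
    if "m \<le> n" for m
    using that
  proof (induction m)
    case 0
    have "compactin (topo G) {\<one>}"
      by (simp add: topspace_eq)
    then show ?case
      using subgroup.one_closed[OF P] character_one by (intro exI[of _ "{\<one>}"]) auto
  next
    case (Suc m)
    then obtain K where K: "compactin (topo G) K" "K \<subseteq> exp_image G"
      and z: "\<And>z. (\<And>i. i < n \<Longrightarrow> norm (z i) = 1) \<Longrightarrow>
          \<exists>k\<in>K. \<forall>i<n. \<phi> i k = (if i < m then z i else (1 :: complex))"
      by (metis Suc_leD)
    let ?C = "r m ` {0..2 * pi}"
    have "compactin (topo G) ?C"
      using r[of m] Suc.prems by (intro image_compactin[of euclideanreal]) (auto simp: carrier_lie_iff)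
    then have "compactin (topo G) (K <#> ?C)"
      by (intro compactin_set_mult K)
    moreover have "K <#> ?C \<subseteq> exp_image G"
      using K(2) r_exp Suc.prems P by (auto simp: set_mult_def intro!: subgroup.m_closed[OF P])
    moreover have "\<exists>k\<in>K <#> ?C. \<forall>i<n. \<phi> i k = (if i < Suc m then z i else 1)"
      if unit: "\<And>i. i < n \<Longrightarrow> norm (z i) = 1" for z
    proof -
      obtain k where k: "k \<in> K" "\<And>i. i < n \<Longrightarrow> \<phi> i k = (if i < m then z i else 1)"
        using z[of z] unit by blast
      have "norm (z m) = 1" using unit Suc.prems by simp
      then have "z m = cis (Arg2pi (z m))"
        by (simp add: complex_norm_eq_1_exp cis_conv_exp)
      moreover have "Arg2pi (z m) \<in> {0..2 * pi}"
        using Arg2pi[of "z m"] by simp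
      ultimately obtain t where t: "t \<in> {0..2 * pi}" "z m = cis t"
        by blast
      have "\<phi> i (k \<otimes> r m t) = (if i < Suc m then z i else 1)" if "i < n" for i
      proof -
        have "k \<in> carrier G" "r m t \<in> carrier G"
          using k(1) K(2) subgroup.subset[OF P] r_exp[of m t] Suc.prems by auto
        then show ?thesis
          using that k(2)[OF that] dual[of m i t] Suc.prems t(2)
          by (auto simp: character_mult less_Suc_eq)
      qed
      moreover have "k \<otimes> r m t \<in> K <#> ?C"
        using k(1) t(1) unfolding set_mult_def by blast
      ultimately show ?thesis by blast
    qed
    ultimately show ?case by blast
  qed
  from this[of n] obtain K where K: "compactin (topo G) K" "K \<subseteq> exp_image G"
    and z: "\<And>z. (\<And>i. i < n \<Longrightarrow> norm (z i) = 1) \<Longrightarrow> \<exists>k\<in>K. \<forall>i<n. \<phi> i k = (z i :: complex)"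
    by (metis (no_types, lifting) order_refl)
  have sub: "K \<subseteq> carrier G" "\<Delta> \<subseteq> carrier G"
    using K(2) subgroup.subset[OF P] subgroup.subset[OF kernel_subgroup] by auto
  have "x \<in> \<Delta> <#> K" if x: "x \<in> carrier G" for x
  proof -
    obtain k where k: "k \<in> K" "\<And>i. i < n \<Longrightarrow> \<phi> i k = \<phi> i x"
      using z[of "\<lambda>i. \<phi> i x"] norm_character by blast
    then have kc: "k \<in> carrier G" using sub by auto
    have "x \<otimes> inv k \<in> \<Delta>"
      using x kc k(2) by (intro kernel) simp_all
    moreover have "x = (x \<otimes> inv k) \<otimes> k"
      using x kc by (simp add: m_assoc)
    ultimately show ?thesis
      using k(1) unfolding set_mult_def by blast
  qed
  then have "\<Delta> <#> K = carrier G"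
    using set_mult_closed[OF sub(2,1)] by blast
  with K show thesis
    by (rule that)
qed

theorem lemma5:
  fixes G :: "'a tgroup" and \<Delta> :: "'a set"
  assumes "protorus G" and "finite_dimensional G" and "torus_free G"
    and "subgroup \<Delta> G" and "profinite_group (subgroup_space G \<Delta>)"
    and "quotient_space G \<Delta> \<cong>\<^sub>t torus (group_dim G)"
  shows "topo G closure_of Z_lattice G \<Delta> = \<Delta> \<and>
         closedin (subtopology (topo G) (exp_image G)) (Z_lattice G \<Delta>)"
proof
  interpret G: protorus G by fact
  have G: "topological_abelian_group G" by unfold_locales
  obtain \<phi> where "kernel_of_circle_characters G \<Delta> (group_dim G) \<phi>"
    using kernel_of_circle_characters_if_torus_quotient[OF G assms(4,6)] .
  then interpret kernel_of_circle_characters G \<Delta> "group_dim G" \<phi> .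
  obtain r where "\<And>i. i < group_dim G \<Longrightarrow> r i \<in> carrier (lie G)"
    and "\<And>i j t. i < group_dim G \<Longrightarrow> j < group_dim G \<Longrightarrow>
        \<phi> j (r i t) = (if i = j then cis t else 1)"
    by (rule dual_one_parameter_subgroups[OF assms(5,2) refl]) (rule that)
  then obtain K where "compactin (topo G) K" "K \<subseteq> exp_image G" "\<Delta> <#>\<^bsub>G\<^esub> K = carrier G"
    by (rule compact_fundamental_domain_in_exp_image)
  then have closure: "topo G closure_of (\<Delta> \<inter> exp_image G) = \<Delta>"
    by (intro closure_of_lattice_eq_if_compact_fundamental_domain assms subgroup_exp_image G)
  then show "topo G closure_of Z_lattice G \<Delta> = \<Delta>"
    by (simp add: Z_lattice_def)
  have "closedin (topo G) \<Delta>"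
    using closedin_closure_of[of "topo G" "\<Delta> \<inter> exp_image G"] by (simp add: closure)
  then show "closedin (subtopology (topo G) (exp_image G)) (Z_lattice G \<Delta>)"
    by (auto simp: closedin_subtopology Z_lattice_def)
qed

end
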